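(* Let $(\beta_t)_{t\ge 0}$ be a standard Brownian motion with respect to a filtration $(\mathcal{G}_t)_{t\ge 0}$, and let $T$ be a bounded $(\mathcal{G}_t)_{t\ge 0}$-stopping time with $\mathbf{E}(T)=1$. Assume that $T$ and $\beta_T$ are independent. Suppose that $\beta_T$ has the standard normal law $N(0,1)$. Then $T=1$ almost surely.
   Context: "Bounded" means that there is a constant $M>0$ such that $T\le M$ almost surely. *)

theory Defs
  imports "HOL-Probability.Probability"
begin

text \<open>
  Filtrations are indexed by \<^typ>\<open>ennreal\<close>, so that stopping times may take the value
  \<open>\<infinity>\<close> and \<^const>\<open>filtration\<close> and \<^const>\<open>stopping_time\<close> apply as they are.  A filtration
  indexed by the nonnegative reals extends to this index type by putting the ambient
  \<open>\<sigma>\<close>-algebra at \<open>\<infinity>\<close>; this places no additional condition on a stopping time, as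
  \<open>T \<omega> \<le> \<infinity>\<close> always holds.

  The process itself has real time; its values at negative times are irrelevant.  Start at the
  origin and continuity of the paths are required almost surely, and neither completeness nor
  right-continuity of the filtration is required.
\<close>

locale brownian_motion =
  prob_space M + filtration "space M" G
  for M :: "'a measure" and G :: "ennreal \<Rightarrow> 'a measure" +
  fixes B :: "real \<Rightarrow> 'a \<Rightarrow> real"
  assumes sets_G_subset: "sets (G t) \<subseteq> sets M"
    and adapted: "0 \<le> s \<Longrightarrow> B s \<in> borel_measurable (G (ennreal s))"
    and start: "AE \<omega> in M. B 0 \<omega> = 0"
    and increment_indep: "0 \<le> s \<Longrightarrow> s < u \<Longrightarrow>
      indep_set (sets (G (ennreal s)))
        (sets (vimage_algebra (space M) (\<lambda>\<omega>. B u \<omega> - B s \<omega>) borel))"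
    and increment_normal: "0 \<le> s \<Longrightarrow> s < u \<Longrightarrow>
      distributed M lborel (\<lambda>\<omega>. B u \<omega> - B s \<omega>) (normal_density 0 (sqrt (u - s)))"
    and continuous_paths: "AE \<omega> in M. continuous_on {0..} (\<lambda>s. B s \<omega>)"

text \<open>
  The process \<open>B\<close> evaluated at the random time \<open>T\<close>.  As \<open>enn2real \<infinity> = 0\<close>, the value is \<open>B 0\<close>
  where \<open>T\<close> is infinite; this is a null event when \<open>T\<close> is almost surely finite.
\<close>

definition at_time :: "(real \<Rightarrow> 'a \<Rightarrow> real) \<Rightarrow> ('a \<Rightarrow> ennreal) \<Rightarrow> 'a \<Rightarrow> real" where
  "at_time B T \<omega> = B (enn2real (T \<omega>)) \<omega>"

end

theory Submission
  imports Defs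
begin

text \<open>
  The proof is the equality case of Jensen's inequality, applied to the exponential
  martingale of Brownian motion.

  The process \<open>exp (l * B\<^sub>s - l\<^sup>2 * s / 2)\<close> is a nonnegative martingale with mean \<open>1\<close>, so
  stopping it at an almost surely finite time \<open>T\<close> yields a mean of at most \<open>1\<close>
  (\<open>nn_integral_exp_process_le_1\<close>).  The mean is exactly \<open>1\<close> when \<open>T\<close> is replaced by its
  discretisation on a finite grid, by induction over the grid points
  (\<open>nn_integral_stopped_exp_process\<close>); Fatou's lemma and the continuity of the paths carry
  the inequality over to \<open>T\<close> as the grid is refined.

  Take \<open>l = 1\<close>.  As \<open>T\<close> and \<open>B\<^sub>T\<close> are independent and \<open>B\<^sub>T\<close> is standard normal, the mean of
  \<open>exp (B\<^sub>T - T / 2)\<close> factorises as \<open>exp (1 / 2)\<close> times the mean of \<open>exp (- T / 2)\<close>.  Hence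
  the variable \<open>X = (1 - T) / 2\<close>, which has mean \<open>0\<close>, satisfies \<open>E (exp X) \<le> 1\<close>.  But
  \<open>exp x \<ge> 1 + x\<close> with equality only at \<open>x = 0\<close>, so \<open>X = 0\<close> almost surely
  (\<open>AE_eq_0_if_nn_integral_exp_le_1\<close>).
\<close>

section \<open>Independence and exponential moments\<close>

lemma (in prob_space) nn_integral_mult_indep_set:
  fixes f g :: "'a \<Rightarrow> ennreal"
  assumes indep: "indep_set (sets F) (sets H)"
    and [simp]: "space F = space M" "space H = space M"
    and f: "f \<in> borel_measurable F" and g: "g \<in> borel_measurable H"
  shows "(\<integral>\<^sup>+\<omega>. f \<omega> * g \<omega> \<partial>M) = (\<integral>\<^sup>+\<omega>. f \<omega> \<partial>M) * (\<integral>\<^sup>+\<omega>. g \<omega> \<partial>M)"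
proof -
  have sub: "subalgebra M F" "subalgebra M H"
    using indep_setD_ev1[OF indep] indep_setD_ev2[OF indep] by (auto simp: subalgebra_def)
  have gen: "{h -` A \<inter> space M | A. A \<in> sets borel} \<subseteq> sets N"
    if "h \<in> borel_measurable N" "space N = space M" for h :: "'a \<Rightarrow> ennreal" and N
    using that by (auto simp: measurable_sets dest: measurable_sets)
  have "indep_sets (\<lambda>i. {case_bool f g i -` A \<inter> space M | A. A \<in> sets borel}) UNIV"
  proof (rule indep_sets_mono_sets[OF indep[unfolded indep_set_def]])
    show "{case_bool f g i -` A \<inter> space M | A. A \<in> sets borel} \<subseteq> case_bool (sets F) (sets H) i" for i
      using gen[OF f] gen[OF g] by (cases i) simp_all
  qed
  moreover have "case_bool f g i \<in> borel_measurable M" for i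
    using measurable_from_subalg[OF sub(1) f] measurable_from_subalg[OF sub(2) g]
    by (cases i) auto
  ultimately have "indep_vars (\<lambda>_. borel) (case_bool f g) UNIV"
    unfolding indep_vars_def2 by auto
  from indep_vars_nn_integral[OF _ this] show ?thesis
    by (simp add: UNIV_bool mult.commute)
qed

text \<open>
  Completing the square: tilting the centred normal density by an exponential, normalised as
  here, only shifts its mean to \<open>l * \<sigma>\<^sup>2\<close>, so the total mass stays \<open>1\<close>.
\<close>

lemma nn_integral_exp_normal:
  assumes D: "distributed M lborel X (normal_density 0 \<sigma>)" and \<sigma>: "0 < \<sigma>"
  shows "(\<integral>\<^sup>+\<omega>. exp (l * X \<omega> - l\<^sup>2 * \<sigma>\<^sup>2 / 2) \<partial>M) = 1"
proof -
  have "(\<integral>\<^sup>+\<omega>. exp (l * X \<omega> - l\<^sup>2 * \<sigma>\<^sup>2 / 2) \<partial>M)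
      = (\<integral>\<^sup>+x. ennreal (normal_density 0 \<sigma> x) * exp (l * x - l\<^sup>2 * \<sigma>\<^sup>2 / 2) \<partial>lborel)"
    by (rule distributed_nn_integral[OF D, symmetric]) simp
  also have "\<dots> = (\<integral>\<^sup>+x. ennreal (normal_density (l * \<sigma>\<^sup>2) \<sigma> x) \<partial>lborel)"
  proof (rule nn_integral_cong)
    fix x :: real
    have "- x\<^sup>2 / (2 * \<sigma>\<^sup>2) + (l * x - l\<^sup>2 * \<sigma>\<^sup>2 / 2) = - (x - l * \<sigma>\<^sup>2)\<^sup>2 / (2 * \<sigma>\<^sup>2)"
      using \<sigma> by (simp add: field_simps power2_eq_square)
    then have "normal_density 0 \<sigma> x * exp (l * x - l\<^sup>2 * \<sigma>\<^sup>2 / 2)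
        = normal_density (l * \<sigma>\<^sup>2) \<sigma> x"
      by (simp add: normal_density_def exp_add[symmetric])
    then show "ennreal (normal_density 0 \<sigma> x) * exp (l * x - l\<^sup>2 * \<sigma>\<^sup>2 / 2)
        = ennreal (normal_density (l * \<sigma>\<^sup>2) \<sigma> x)"
      by (simp add: ennreal_mult[symmetric])
  qed
  also have "\<dots> = emeasure (density lborel (normal_density (l * \<sigma>\<^sup>2) \<sigma>)) UNIV"
    by (simp add: emeasure_density)
  also have "\<dots> = 1"
    using prob_space.emeasure_space_1[OF prob_space_normal_density[OF \<sigma>]] by simp
  finally show ?thesis .
qed

text \<open>
  The equality case of Jensen's inequality for the exponential: \<open>exp X - (1 + X)\<close> is a
  nonnegative variable whose mean is at most \<open>0\<close>.
\<close>

lemma (in prob_space) AE_eq_0_if_nn_integral_exp_le_1: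
  fixes X :: "'a \<Rightarrow> real"
  assumes X: "integrable M X" "expectation X = 0" and le: "(\<integral>\<^sup>+\<omega>. exp (X \<omega>) \<partial>M) \<le> 1"
  shows "AE \<omega> in M. X \<omega> = 0"
proof -
  have [measurable]: "X \<in> borel_measurable M" using X by auto
  have int: "integrable M (\<lambda>\<omega>. exp (X \<omega>))"
    using le by (intro integrableI_nonneg) (auto intro: le_less_trans)
  have "expectation (\<lambda>\<omega>. exp (X \<omega>)) \<le> 1"
    using le nn_integral_eq_integral[OF int] by simp
  moreover have gap: "0 \<le> exp (X \<omega>) - (1 + X \<omega>)" for \<omega>
    using exp_ge_add_one_self[of "X \<omega>"] by simp
  moreover have "expectation (\<lambda>\<omega>. exp (X \<omega>) - (1 + X \<omega>)) = expectation (\<lambda>\<omega>. exp (X \<omega>)) - 1"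
    using X int by (simp add: prob_space)
  moreover have "0 \<le> expectation (\<lambda>\<omega>. exp (X \<omega>) - (1 + X \<omega>))"
    using gap by (intro integral_nonneg_AE) auto
  ultimately have "expectation (\<lambda>\<omega>. exp (X \<omega>) - (1 + X \<omega>)) = 0" by linarith
  then have "AE \<omega> in M. exp (X \<omega>) - (1 + X \<omega>) = 0"
    using X int gap by (subst (asm) integral_nonneg_eq_0_iff_AE) auto
  then show ?thesis
  proof eventually_elim
    case (elim \<omega>)
    then have "ln (exp (X \<omega>)) = exp (X \<omega>) - 1" unfolding ln_exp by simp
    then have "exp (X \<omega>) = 1" by (rule ln_eq_minus_one[OF exp_gt_zero])
    then show ?case by simp
  qed
qed

section \<open>Discretisation of a time\<close>

text \<open>
  The index of the first point of the grid \<open>0, h, 2 * h, \<dots>\<close> (for \<open>h > 0\<close>) that is not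
  before \<open>t\<close>, or \<open>n\<close> if this index exceeds \<open>n\<close>.  The recursion in \<open>n\<close> is the one that the martingale induction
  follows: whether to advance from \<open>n\<close> to \<open>Suc n\<close> is decided by the event \<open>t \<le> h * n\<close>, which is
  known at time \<open>h * n\<close> if \<open>t\<close> is a stopping time.
\<close>

primrec stopped_index :: "real \<Rightarrow> ennreal \<Rightarrow> nat \<Rightarrow> nat" where
  "stopped_index h t 0 = 0"
| "stopped_index h t (Suc n) =
    (if t \<le> ennreal (h * real n) then stopped_index h t n else Suc n)"

lemma stopped_index_bounds:
  assumes "0 < h" "0 \<le> t"
  shows "h * stopped_index h (ennreal t) n < t + h"
    and "t \<le> h * real n \<Longrightarrow> t \<le> h * stopped_index h (ennreal t) n"
  using assms by (induction n) (auto simp: field_simps not_le)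

lemma stopped_index_eq: "0 \<le> h \<Longrightarrow> ennreal (h * real n) < t \<Longrightarrow> stopped_index h t n = n"
proof (cases n)
  case (Suc k)
  assume "0 \<le> h" "ennreal (h * real n) < t"
  moreover from this(1) have "ennreal (h * real k) \<le> ennreal (h * real n)"
    unfolding Suc by (intro ennreal_leI mult_left_mono) auto
  ultimately have "\<not> t \<le> ennreal (h * real k)" by (auto simp del: ennreal_le_iff)
  then show ?thesis by (simp add: Suc)
qed simp

section \<open>The stopped exponential martingale\<close>

context brownian_motion
begin

definition exp_process :: "real \<Rightarrow> real \<Rightarrow> 'a \<Rightarrow> real" where
  "exp_process l s \<omega> = exp (l * B s \<omega> - l\<^sup>2 * s / 2)"

lemma borel_measurable_from_filtration: "f \<in> borel_measurable (G t) \<Longrightarrow> f \<in> borel_measurable M"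
  using sets_G_subset space_F
  by (auto intro: measurable_from_subalg[of M "G t"] simp: subalgebra_def)

lemma borel_measurable_exp_process:
  "0 \<le> s \<Longrightarrow> exp_process l s \<in> borel_measurable (G (ennreal s))"
  using adapted[of s] unfolding exp_process_def[abs_def] by measurable

text \<open>
  Optional stopping on a grid.  From step \<open>n\<close> to \<open>Suc n\<close> the stopped process is frozen where
  \<open>T \<le> h * n\<close>; elsewhere it still equals the exponential process at \<open>h * n\<close> and is multiplied by
  the exponential of the next increment.  That factor has mean \<open>1\<close> and is independent of the
  past, hence also of the event on which it is applied, so the mean does not change.
  Measurability at time \<open>h * n\<close> is proved along the way, as the independence needs it.
\<close>

lemma nn_integral_stopped_exp_process:
  assumes T: "stopping_time G T" and h: "0 < h"
  shows "(\<lambda>\<omega>. exp_process l (h * stopped_index h (T \<omega>) n) \<omega>) \<in> borel_measurable (G (ennreal (h * n)))"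
    and "(\<integral>\<^sup>+\<omega>. exp_process l (h * stopped_index h (T \<omega>) n) \<omega> \<partial>M) = 1"
proof (induction n)
  case 0
  { case 1 show ?case using borel_measurable_exp_process[of 0] by simp }
  { case 2
    have "(\<integral>\<^sup>+\<omega>. exp_process l 0 \<omega> \<partial>M) = (\<integral>\<^sup>+\<omega>. 1 \<partial>M)"
      using start by (intro nn_integral_cong_AE) (auto simp: exp_process_def)
    then show ?case by (simp add: emeasure_space_1) }
next
  case (Suc n)
  define s u where "s = h * real n" and "u = h * real (Suc n)"
  have su: "0 \<le> s" "s < u" "u - s = h" using h by (auto simp: s_def u_def field_simps)
  define W where "W k \<omega> = exp_process l (h * stopped_index h (T \<omega>) k) \<omega>" for k \<omega>
  have W_Suc: "W (Suc n) \<omega> = (if T \<omega> \<le> ennreal s then W n \<omega> else exp_process l u \<omega>)" for \<omega>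
    by (simp add: W_def s_def u_def)
  have W_before: "W n \<omega> = exp_process l s \<omega>" if "\<not> T \<omega> \<le> ennreal s" for \<omega>
    using that h stopped_index_eq[of h n "T \<omega>"] by (auto simp: W_def s_def)
  have [measurable]: "W n \<in> borel_measurable (G (ennreal s))"
    using Suc(1) by (simp add: W_def[abs_def] s_def)
  have [measurable]: "Measurable.pred (G (ennreal s)) (\<lambda>\<omega>. T \<omega> \<le> ennreal s)"
    by (rule stopping_timeD[OF T])
  have sub: "subalgebra (G (ennreal u)) (G (ennreal s))"
    using su sets_F_mono[of "ennreal s" "ennreal u"] by (auto simp: subalgebra_def space_F ennreal_leI)
  { case 1
    have "(\<lambda>\<omega>. if T \<omega> \<le> ennreal s then W n \<omega> else exp_process l u \<omega>) \<in> borel_measurable (G (ennreal u))"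
    proof (rule measurable_If)
      show "W n \<in> borel_measurable (G (ennreal u))"
        by (rule measurable_from_subalg[OF sub]) measurable
      show "exp_process l u \<in> borel_measurable (G (ennreal u))"
        using su by (intro borel_measurable_exp_process) simp
      show "{\<omega> \<in> space (G (ennreal u)). T \<omega> \<le> ennreal s} \<in> sets (G (ennreal u))"
        using measurable_from_subalg[OF sub stopping_timeD[OF T, of "ennreal s"]]
        by (simp add: pred_def)
    qed
    then show ?case unfolding W_Suc[symmetric] by (simp add: W_def[abs_def] u_def) }
  { case 2
    \<comment> \<open>\<open>f\<close> is the part that still moves, \<open>f'\<close> the frozen part and \<open>R\<close> the multiplicative increment;
      the variance in \<open>R\<close> is written as in the law of the increment.\<close>
    define f where "f \<omega> = (if T \<omega> \<le> ennreal s then 0 else ennreal (W n \<omega>))" for \<omega>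
    define f' where "f' \<omega> = (if T \<omega> \<le> ennreal s then ennreal (W n \<omega>) else 0)" for \<omega>
    define R where "R \<omega> = exp (l * (B u \<omega> - B s \<omega>) - l\<^sup>2 * (sqrt (u - s))\<^sup>2 / 2)" for \<omega>
    have f_G [measurable]: "f \<in> borel_measurable (G (ennreal s))" "f' \<in> borel_measurable (G (ennreal s))"
      unfolding f_def[abs_def] f'_def[abs_def] by measurable
    have R_incr: "(\<lambda>\<omega>. ennreal (R \<omega>)) \<in> borel_measurable (vimage_algebra (space M) (\<lambda>\<omega>. B u \<omega> - B s \<omega>) borel)"
      unfolding R_def
      by (rule measurable_compose[OF measurable_vimage_algebra1]) auto
    have f_M [measurable]: "f \<in> borel_measurable M" "f' \<in> borel_measurable M"
      by (rule borel_measurable_from_filtration[OF f_G(1)], rule borel_measurable_from_filtration[OF f_G(2)])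
    have [measurable]: "B u \<in> borel_measurable M" "B s \<in> borel_measurable M"
      using su by (simp_all add: borel_measurable_from_filtration[OF adapted])
    have [measurable]: "(\<lambda>\<omega>. ennreal (R \<omega>)) \<in> borel_measurable M"
      unfolding R_def by measurable
    have R1: "(\<integral>\<^sup>+\<omega>. R \<omega> \<partial>M) = 1"
      unfolding R_def using su by (intro nn_integral_exp_normal increment_normal) auto
    have step: "ennreal (W (Suc n) \<omega>) = f' \<omega> + f \<omega> * ennreal (R \<omega>)" for \<omega>
    proof -
      have "exp_process l s \<omega> * R \<omega> = exp_process l u \<omega>"
        using su by (simp add: exp_process_def R_def exp_add[symmetric] field_simps)
      then have "ennreal (exp_process l s \<omega>) * ennreal (R \<omega>) = ennreal (exp_process l u \<omega>)"
        by (simp add: ennreal_mult[symmetric] exp_process_def R_def)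
      then show ?thesis
        by (simp add: W_Suc f_def f'_def W_before)
    qed
    have "(\<integral>\<^sup>+\<omega>. W (Suc n) \<omega> \<partial>M) = (\<integral>\<^sup>+\<omega>. f' \<omega> \<partial>M) + (\<integral>\<^sup>+\<omega>. f \<omega> * ennreal (R \<omega>) \<partial>M)"
      unfolding step by (rule nn_integral_add) measurable
    also have "(\<integral>\<^sup>+\<omega>. f \<omega> * ennreal (R \<omega>) \<partial>M) = (\<integral>\<^sup>+\<omega>. f \<omega> \<partial>M)"
      using nn_integral_mult_indep_set[OF increment_indep[OF su(1,2)] _ _ f_G(1) R_incr] R1
      by (simp add: space_F)
    also have "(\<integral>\<^sup>+\<omega>. f' \<omega> \<partial>M) + (\<integral>\<^sup>+\<omega>. f \<omega> \<partial>M) = (\<integral>\<^sup>+\<omega>. f' \<omega> + f \<omega> \<partial>M)"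
      by (rule nn_integral_add[symmetric]) measurable
    also have "\<dots> = (\<integral>\<^sup>+\<omega>. W n \<omega> \<partial>M)"
      by (intro nn_integral_cong) (auto simp: f_def f'_def)
    also have "\<dots> = 1" using Suc(2) by (simp add: W_def)
    finally show ?case by (simp add: W_def) }
qed

text \<open>
  The grid of mesh \<open>1 / Suc m\<close> is followed up to time \<open>m\<close>, so that the discretised times
  approach every finite value of \<open>T\<close> while each of them takes only finitely many values.
  The limit is taken by Fatou's lemma, which turns the equality on the grids into an inequality.
\<close>

lemma nn_integral_exp_process_le_1:
  assumes T: "stopping_time G T" and fin: "AE \<omega> in M. T \<omega> < \<infinity>"
  shows "(\<integral>\<^sup>+\<omega>. exp_process l (enn2real (T \<omega>)) \<omega> \<partial>M) \<le> 1"
proof -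
  define h where "h m = 1 / real (Suc m)" for m
  define \<sigma> where "\<sigma> m \<omega> = h m * stopped_index (h m) (T \<omega>) (Suc m * m)" for m \<omega>
  have h_pos: "0 < h m" for m by (simp add: h_def)
  have lim: "(\<lambda>m. \<sigma> m \<omega>) \<longlonglongrightarrow> t" if t: "T \<omega> = ennreal t" "0 \<le> t" for \<omega> t
  proof (rule tendsto_sandwich)
    have horizon: "h m * real (Suc m * m) = real m" for m
      unfolding h_def of_nat_mult by simp
    show "\<forall>\<^sub>F m in sequentially. t \<le> \<sigma> m \<omega>"
      using eventually_ge_at_top[of "nat \<lceil>t\<rceil>"]
    proof eventually_elim
      case (elim m)
      then have "t \<le> real m" by linarith
      then show ?case
        unfolding \<sigma>_def t(1) by (intro stopped_index_bounds(2) h_pos t) (simp only: horizon)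
    qed
    show "\<forall>\<^sub>F m in sequentially. \<sigma> m \<omega> \<le> t + h m"
      unfolding \<sigma>_def t(1)
      by (intro always_eventually allI less_imp_le stopped_index_bounds(1) h_pos t)
    have "h \<longlonglongrightarrow> 0" unfolding h_def[abs_def] by (rule LIMSEQ_Suc[OF lim_1_over_n])
    from tendsto_add[OF tendsto_const this, of t] show "(\<lambda>m. t + h m) \<longlonglongrightarrow> t" by simp
  qed simp
  have meas: "(\<lambda>\<omega>. ennreal (exp_process l (\<sigma> m \<omega>) \<omega>)) \<in> borel_measurable M" for m
    unfolding \<sigma>_def using nn_integral_stopped_exp_process(1)[OF T h_pos]
    by (intro measurable_compose[OF _ measurable_ennreal]) (rule borel_measurable_from_filtration)
  have "(\<integral>\<^sup>+\<omega>. exp_process l (enn2real (T \<omega>)) \<omega> \<partial>M)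
      = (\<integral>\<^sup>+\<omega>. liminf (\<lambda>m. ennreal (exp_process l (\<sigma> m \<omega>) \<omega>)) \<partial>M)"
  proof (rule nn_integral_cong_AE)
    show "AE \<omega> in M. ennreal (exp_process l (enn2real (T \<omega>)) \<omega>)
        = liminf (\<lambda>m. ennreal (exp_process l (\<sigma> m \<omega>) \<omega>))"
      using continuous_paths fin
    proof eventually_elim
      case (elim \<omega>)
      define t where "t = enn2real (T \<omega>)"
      have t: "T \<omega> = ennreal t" "0 \<le> t" using elim(2) by (auto simp: t_def)
      have "(\<lambda>m. B (\<sigma> m \<omega>) \<omega>) \<longlonglongrightarrow> B t \<omega>"
        by (rule continuous_on_tendsto_compose[OF elim(1) lim[OF t]])
           (use t(2) in \<open>auto simp: \<sigma>_def intro!: always_eventually mult_nonneg_nonneg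
              less_imp_le[OF h_pos]\<close>)
      then have "(\<lambda>m. ennreal (exp_process l (\<sigma> m \<omega>) \<omega>)) \<longlonglongrightarrow> ennreal (exp_process l t \<omega>)"
        unfolding exp_process_def by (intro tendsto_intros lim[OF t]) simp_all
      then show ?case
        by (simp add: lim_imp_Liminf t_def)
    qed
  qed
  also have "\<dots> \<le> liminf (\<lambda>m. \<integral>\<^sup>+\<omega>. exp_process l (\<sigma> m \<omega>) \<omega> \<partial>M)"
    by (rule nn_integral_liminf[OF meas])
  also have "\<dots> = 1"
    unfolding \<sigma>_def nn_integral_stopped_exp_process(2)[OF T h_pos] by (simp add: Liminf_const)
  finally show ?thesis .
qed

end

section \<open>The stopping time is constant\<close>

theorem theorem2:
  fixes M :: "'a measure"
    and G :: "ennreal \<Rightarrow> 'a measure"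
    and \<beta> :: "real \<Rightarrow> 'a \<Rightarrow> real"
    and T :: "'a \<Rightarrow> ennreal"
  assumes "brownian_motion M G \<beta>"
    and "stopping_time G T"
    and "\<exists>K::real. K > 0 \<and> (AE \<omega> in M. T \<omega> \<le> ennreal K)"
    and "(\<integral>\<^sup>+ \<omega>. T \<omega> \<partial>M) = 1"
    and "prob_space.indep_set M (sets (vimage_algebra (space M) T borel))
           (sets (vimage_algebra (space M) (at_time \<beta> T) borel))"
    and "distributed M lborel (at_time \<beta> T) std_normal_density"
  shows "AE \<omega> in M. T \<omega> = 1"
proof -
  interpret brownian_motion M G \<beta> by fact
  define t where "t \<omega> = enn2real (T \<omega>)" for \<omega>
  define Z where "Z \<omega> = at_time \<beta> T \<omega>" for \<omega>
  have T_meas [measurable]: "T \<in> borel_measurable M"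
    using assms(2) sets_G_subset space_F by (rule measurable_stopping_time)
  have fin: "AE \<omega> in M. T \<omega> < \<infinity>"
    using assms(3) by (auto elim!: eventually_mono intro: le_less_trans)
  then have T_eq: "AE \<omega> in M. T \<omega> = ennreal (t \<omega>)"
    by eventually_elim (simp add: t_def)
  have [measurable]: "t \<in> borel_measurable M" unfolding t_def[abs_def] by measurable
  have nn_t: "(\<integral>\<^sup>+\<omega>. t \<omega> \<partial>M) = ennreal 1"
    using assms(4) nn_integral_cong_AE[OF T_eq] by simp
  have t_has: "has_bochner_integral M t 1"
    using nn_t by (intro has_bochner_integral_nn_integral) (auto simp: t_def)
  \<comment> \<open>The factor \<open>1\<close> is the mean of \<open>exp (Z - 1 / 2)\<close>, by normality of \<open>Z\<close>.\<close>
  have "1 * (\<integral>\<^sup>+\<omega>. exp ((1 - t \<omega>) / 2) \<partial>M)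
      = (\<integral>\<^sup>+\<omega>. exp (Z \<omega> - 1 / 2) \<partial>M) * (\<integral>\<^sup>+\<omega>. exp ((1 - t \<omega>) / 2) \<partial>M)"
    using nn_integral_exp_normal[OF assms(6), of 1] by (simp add: Z_def)
  also have "\<dots> = (\<integral>\<^sup>+\<omega>. ennreal (exp ((1 - t \<omega>) / 2)) * ennreal (exp (Z \<omega> - 1 / 2)) \<partial>M)"
  proof -
    have "(\<lambda>\<omega>. ennreal (exp ((1 - t \<omega>) / 2))) \<in> borel_measurable (vimage_algebra (space M) T borel)"
      unfolding t_def by (rule measurable_compose[OF measurable_vimage_algebra1]) auto
    moreover have "(\<lambda>\<omega>. ennreal (exp (Z \<omega> - 1 / 2)))
        \<in> borel_measurable (vimage_algebra (space M) (at_time \<beta> T) borel)"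
      unfolding Z_def by (rule measurable_compose[OF measurable_vimage_algebra1]) auto
    ultimately show ?thesis
      by (subst nn_integral_mult_indep_set[OF assms(5)]) (simp_all add: mult.commute)
  qed
  also have "\<dots> = (\<integral>\<^sup>+\<omega>. exp_process 1 (enn2real (T \<omega>)) \<omega> \<partial>M)"
    by (intro nn_integral_cong)
       (simp add: ennreal_mult[symmetric] exp_add[symmetric] exp_process_def Z_def at_time_def t_def
         field_simps)
  also have "\<dots> \<le> 1"
    by (rule nn_integral_exp_process_le_1[OF assms(2) fin])
  finally have "(\<integral>\<^sup>+\<omega>. exp ((1 - t \<omega>) / 2) \<partial>M) \<le> 1" by simp
  moreover have "integrable M (\<lambda>\<omega>. (1 - t \<omega>) / 2)" "expectation (\<lambda>\<omega>. (1 - t \<omega>) / 2) = 0"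
    using t_has by (auto simp: has_bochner_integral_iff prob_space)
  ultimately have "AE \<omega> in M. (1 - t \<omega>) / 2 = 0"
    by (intro AE_eq_0_if_nn_integral_exp_le_1)
  with T_eq show ?thesis by eventually_elim simp
qed

end
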